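(* Let $\mathbb{F}\in\{\mathbb{R},\mathbb{C}\}$, let $T$ be an $n$-simplex, and let $k,r\in\mathbb{N}_0$. Let $\mathcal{I}_{k,r} : \mathcal{P}_{r}\Lambda^{k}(T) \to \mathring{\mathcal{P}}^{-}_{r+k+1}\Lambda^{n-k}(T)$ and $\mathcal{J}_{k,r} : \mathcal{P}_{r+1}^{-}\Lambda^{k}(T) \to \mathring{\mathcal{P}}_{r+k+1}\Lambda^{n-k}(T)$ be the canonical isomorphisms. Then: (1) A finite set $\mathcal{Q}\subseteq\mathcal{P}_{r}\Lambda^{k}(T)$ is $\mathbb{F}$-invariant if and only if $\mathcal{I}_{k,r}\mathcal{Q}\subseteq\mathring{\mathcal{P}}_{r+k+1}^{-}\Lambda^{n-k}(T)$ is $\mathbb{F}$-invariant. (2) A finite set $\mathcal{Q}\subseteq\mathcal{P}_{r+1}^{-}\Lambda^{k}(T)$ is $\mathbb{F}$-invariant if and only if $\mathcal{J}_{k,r}\mathcal{Q}\subseteq\mathring{\mathcal{P}}_{r+k+1}\Lambda^{n-k}(T)$ is $\mathbb{F}$-invariant.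
   Context: **Simplices and symmetries.** $T$ is the convex hull of affinely independent points $v_0,\dots,v_n$ in a Euclidean space, with this vertex order. $[0:n]=\{0,\dots,n\}$; $\mathrm{Perm}(n)$ is the group of permutations of $[0:n]$. For $\pi\in\mathrm{Perm}(n)$, $S_\pi:T\to T$ is the affine automorphism with $S_\pi(v_i)=v_{\pi^{-1}(i)}$. **Invariance.** A finite set $\{\omega_1,\dots,\omega_M\}$ of pairwise distinct differential forms on $T$ with coefficients in $\mathbb{F}$ is $\mathbb{F}$-invariant if for every $\pi\in\mathrm{Perm}(n)$ there are a permutation $\tau$ of $\{1,\dots,M\}$ and $\chi_1,\dots,\chi_M\in\mathbb{F}$ with $|\chi_i|=1$ and $S_\pi^*\omega_i=\chi_i\omega_{\tau(i)}$ for all $i$. **Forms.** $\lambda_0,\dots,\lambda_n$ are the barycentric coordinates of $T$, $d\lambda_i$ their exterior derivatives. $A(r,n)$ is the set of $\alpha:[0:n]\to\mathbb{N}_0$ with $\sum_i\alpha(i)=r$; $\lambda^\alpha=\prod_i\lambda_i^{\alpha(i)}$. $\Sigma(k,n)$ and $\Sigma_0(k,n)$ are the sets of strictly increasing maps $\{1,\dots,k\}\to[0:n]$ and $\{0,\dots,k\}\to[0:n]$ ($\Sigma(0,n)=\{\emptyset\}$). $d\lambda_\sigma=d\lambda_{\sigma(1)}\wedge\dots\wedge d\lambda_{\sigma(k)}$ ($=1$ if $k=0$), $\phi_\rho=\sum_{i=0}^k(-1)^i\lambda_{\rho(i)}\,d\lambda_{\rho(0)}\wedge\dots\widehat{d\lambda_{\rho(i)}}\dots\wedge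 d\lambda_{\rho(k)}$ (Whitney form), $\lambda_\sigma=\prod_{i=1}^k\lambda_{\sigma(i)}$, $\lambda_\rho=\prod_{i=0}^k\lambda_{\rho(i)}$. $\sigma^c\in\Sigma_0(n-k,n)$, $\rho^c\in\Sigma(n-k,n)$ are the increasing enumerations of the complements in $[0:n]$ of the ranges of $\sigma\in\Sigma(k,n)$, $\rho\in\Sigma_0(k,n)$; $\epsilon(\sigma,\sigma^c)$, resp. $\epsilon(\rho^c,\rho)$, is the sign of the permutation sorting the concatenated sequence ($\sigma$ then $\sigma^c$, resp. $\rho^c$ then $\rho$) in ascending order. **Spaces** (coefficients in $\mathbb{F}$). $\mathcal{P}_r\Lambda^k(T)$ is the span of the $\lambda^\alpha d\lambda_\sigma$, $\alpha\in A(r,n)$, $\sigma\in\Sigma(k,n)$; $\mathcal{P}_r^-\Lambda^k(T)$ is the span of the $\lambda^\alpha\phi_\rho$, $\alpha\in A(r-1,n)$, $\rho\in\Sigma_0(k,n)$; they are zero for $k\notin[0:n]$. $\mathring{\mathcal{P}}_r\Lambda^k(T)$ and $\mathring{\mathcal{P}}^-_r\Lambda^k(T)$ are the subspaces of forms whose pullback to every proper subsimplex of $T$ vanishes. **Canonical isomorphisms.** $\mathcal{I}_{k,r}$ and $\mathcal{J}_{k,r}$ are the (well-defined) linear isomorphisms uniquely determined by $\mathcal{I}_{k,r}(\lambda^\alpha d\lambda_\sigma)=\epsilon(\sigma,\sigma^c)\lambda^\alpha\lambda_\sigma\phi_{\sigma^c}$ and $\mathcal{J}_{k,r}(\lambda^\alpha\phi_\rho)=\epsilon(\rho^c,\rho)\lambda^\alpha\lambda_\rho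 d\lambda_{\rho^c}$ for $\alpha\in A(r,n)$, $\sigma\in\Sigma(k,n)$, $\rho\in\Sigma_0(k,n)$ (they are maps between zero spaces if $k\notin[0:n]$). *)

theory Defs
  imports
    "HOL-Analysis.Analysis"
    "HOL-Combinatorics.Permutations"
    "HOL-Library.Function_Algebras"
begin

section \<open>Differential forms on a convex set\<close>

text \<open>
  A \<open>k\<close>-form on \<open>T\<close> is a function taking a point and a list of \<open>k\<close> tangent vectors. It is
  set to zero unless the point lies in \<open>T\<close>, the list has length \<open>k\<close>, and its entries are tangent to
  the affine hull of \<open>T\<close>; hence two forms on \<open>T\<close> agree iff they are equal as functions.
  The field of coefficients is the type \<open>'f :: real_normed_field\<close>, with
  \<open>real\<close> and \<open>complex\<close> as instances (up to isomorphism, the only ones).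
\<close>

type_synonym ('a, 'f) form = "'a \<Rightarrow> 'a list \<Rightarrow> 'f"

definition form_scale :: "'f::real_normed_field \<Rightarrow> ('a, 'f) form \<Rightarrow> ('a, 'f) form" where
  "form_scale c \<omega> = (\<lambda>x vs. c * \<omega> x vs)"

interpretation form: vector_space form_scale
  by unfold_locales (auto simp: form_scale_def fun_eq_iff algebra_simps)

definition form_mult ::
    "('a \<Rightarrow> real) \<Rightarrow> ('a, 'f::real_normed_field) form \<Rightarrow> ('a, 'f) form" where
  "form_mult f \<omega> = (\<lambda>x vs. of_real (f x) * \<omega> x vs)"

definition tangent_space :: "'a::euclidean_space set \<Rightarrow> 'a set" where
  "tangent_space T = {y - z | y z. y \<in> affine hull T \<and> z \<in> affine hull T}"

definition dir_deriv ::
    "('a::euclidean_space \<Rightarrow> 'b::real_normed_vector) \<Rightarrow> 'a \<Rightarrow> 'a \<Rightarrow> 'b" where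
  "dir_deriv f x w = vector_derivative (\<lambda>t. f (x + t *\<^sub>R w)) (at 0)"

text \<open>The exterior derivative of a function defined on the affine hull of \<open>T\<close>.\<close>

definition ext_deriv ::
    "'a::euclidean_space set \<Rightarrow> ('a \<Rightarrow> real) \<Rightarrow> ('a, 'f::real_normed_field) form" where
  "ext_deriv T f = (\<lambda>x vs.
     if x \<in> T \<and> length vs = 1 \<and> set vs \<subseteq> tangent_space T
     then of_real (dir_deriv f x (hd vs)) else 0)"

text \<open>
  The wedge product of a list of 1-forms, in the convention
  \<open>(\<theta>\<^sub>1 \<and> \<dots> \<and> \<theta>\<^sub>k)(w\<^sub>1, \<dots>, w\<^sub>k) = det (\<theta>\<^sub>i(w\<^sub>j))\<close>;
  the empty product is the constant function 1 on \<open>T\<close>.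
\<close>

definition wedge ::
    "'a::euclidean_space set \<Rightarrow> ('a, 'f::real_normed_field) form list \<Rightarrow> ('a, 'f) form" where
  "wedge T \<theta> = (\<lambda>x vs.
     if x \<in> T \<and> length vs = length \<theta> \<and> set vs \<subseteq> tangent_space T
     then \<Sum>p | p permutes {..<length \<theta>}.
            of_int (sign p) * (\<Prod>i<length \<theta>. (\<theta> ! i) x [vs ! p i])
     else 0)"

text \<open>
  The pullback to \<open>T\<close> of a form along \<open>S\<close>, where \<open>S\<close> is defined on the affine hull of \<open>T\<close>.
\<close>

definition pullback ::
    "'a::euclidean_space set \<Rightarrow> ('a \<Rightarrow> 'a) \<Rightarrow> ('a, 'f::real_normed_field) form \<Rightarrow> ('a, 'f) form" where
  "pullback T S \<omega> = (\<lambda>x vs.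
     if x \<in> T \<and> set vs \<subseteq> tangent_space T then \<omega> (S x) (map (dir_deriv S x) vs) else 0)"


section \<open>Simplices\<close>

definition simplex_vertices :: "(nat \<Rightarrow> 'a::euclidean_space) \<Rightarrow> nat \<Rightarrow> bool" where
  "simplex_vertices v n \<longleftrightarrow> inj_on v {..n} \<and> \<not> affine_dependent (v ` {..n})"

definition simplex_of :: "(nat \<Rightarrow> 'a::euclidean_space) \<Rightarrow> nat \<Rightarrow> 'a set" where
  "simplex_of v n = convex hull (v ` {..n})"

text \<open>
  The barycentric coordinates \<open>\<lambda>\<^sub>i\<close>, extended from the simplex to its affine hull.
\<close>

definition bary :: "(nat \<Rightarrow> 'a::euclidean_space) \<Rightarrow> nat \<Rightarrow> nat \<Rightarrow> 'a \<Rightarrow> real" where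
  "bary v n i x =
     (THE u :: nat \<Rightarrow> real.
        (\<forall>j>n. u j = 0) \<and> (\<Sum>j\<le>n. u j) = 1 \<and> (\<Sum>j\<le>n. u j *\<^sub>R v j) = x) i"

text \<open>The affine map \<open>S\<^sub>\<pi>\<close> sending \<open>v i\<close> to \<open>v (inv \<pi> i)\<close>.\<close>

definition simplex_sym ::
    "(nat \<Rightarrow> 'a::euclidean_space) \<Rightarrow> nat \<Rightarrow> (nat \<Rightarrow> nat) \<Rightarrow> 'a \<Rightarrow> 'a" where
  "simplex_sym v n \<pi> x = (\<Sum>i\<le>n. bary v n i x *\<^sub>R v (inv \<pi> i))"

text \<open>
  A finite set \<open>Q\<close> of forms is indexed by its own elements: \<open>\<tau>\<close> permutes \<open>Q\<close>, and \<open>c \<omega>\<close> is the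
  unimodular factor of \<open>\<omega>\<close>.
\<close>

definition invariant_forms ::
    "(nat \<Rightarrow> 'a::euclidean_space) \<Rightarrow> nat \<Rightarrow> ('a, 'f::real_normed_field) form set \<Rightarrow> bool" where
  "invariant_forms v n Q \<longleftrightarrow> finite Q \<and>
     (\<forall>\<pi>. \<pi> permutes {..n} \<longrightarrow>
       (\<exists>\<tau> c. \<tau> permutes Q \<and>
          (\<forall>\<omega>\<in>Q. norm (c \<omega>) = 1 \<and>
             pullback (simplex_of v n) (simplex_sym v n \<pi>) \<omega> = form_scale (c \<omega>) (\<tau> \<omega>))))"


section \<open>Polynomial differential forms\<close>

definition multiindices :: "int \<Rightarrow> nat \<Rightarrow> (nat \<Rightarrow> nat) set" where
  "multiindices r n = {\<alpha>. (\<forall>i>n. \<alpha> i = 0) \<and> int (\<Sum>i\<le>n. \<alpha> i) = r}"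

text \<open>
  Strictly increasing maps into \<open>{0..n}\<close> are given by the lists of their values, so the domains
  \<open>{1..k}\<close> and \<open>{0..k}\<close> correspond to the lengths \<open>k\<close> and \<open>Suc k\<close>.
\<close>

definition inc_maps :: "nat \<Rightarrow> nat \<Rightarrow> nat list set" where
  "inc_maps k n = {\<sigma>. length \<sigma> = k \<and> sorted_wrt (<) \<sigma> \<and> set \<sigma> \<subseteq> {..n}}"

definition inc_maps0 :: "nat \<Rightarrow> nat \<Rightarrow> nat list set" where
  "inc_maps0 k n = inc_maps (Suc k) n"

definition compl_map :: "nat \<Rightarrow> nat list \<Rightarrow> nat list" where
  "compl_map n \<sigma> = sorted_list_of_set ({..n} - set \<sigma>)"

definition sort_sign :: "nat list \<Rightarrow> int" where
  "sort_sign xs = sign (THE p. p permutes {..<length xs} \<and> sorted (permute_list p xs))"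

definition bary_power :: "(nat \<Rightarrow> 'a::euclidean_space) \<Rightarrow> nat \<Rightarrow> (nat \<Rightarrow> nat) \<Rightarrow> 'a \<Rightarrow> real" where
  "bary_power v n \<alpha> x = (\<Prod>i\<le>n. bary v n i x ^ \<alpha> i)"

definition bary_prod :: "(nat \<Rightarrow> 'a::euclidean_space) \<Rightarrow> nat \<Rightarrow> nat list \<Rightarrow> 'a \<Rightarrow> real" where
  "bary_prod v n \<sigma> x = (\<Prod>i\<leftarrow>\<sigma>. bary v n i x)"

definition dbary ::
    "(nat \<Rightarrow> 'a::euclidean_space) \<Rightarrow> nat \<Rightarrow> nat list \<Rightarrow> ('a, 'f::real_normed_field) form" where
  "dbary v n \<sigma> = wedge (simplex_of v n) (map (\<lambda>i. ext_deriv (simplex_of v n) (bary v n i)) \<sigma>)"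

definition whitney ::
    "(nat \<Rightarrow> 'a::euclidean_space) \<Rightarrow> nat \<Rightarrow> nat list \<Rightarrow> ('a, 'f::real_normed_field) form" where
  "whitney v n \<rho> = (\<Sum>i<length \<rho>.
     form_scale ((-1) ^ i)
       (form_mult (bary v n (\<rho> ! i)) (dbary v n (take i \<rho> @ drop (Suc i) \<rho>))))"

text \<open>
  The form degree \<open>k\<close> is an integer, so that the spaces of degree \<open>n - k\<close> with \<open>k > n\<close> are zero.
\<close>

definition poly_forms ::
    "(nat \<Rightarrow> 'a::euclidean_space) \<Rightarrow> nat \<Rightarrow> nat \<Rightarrow> int \<Rightarrow> ('a, 'f::real_normed_field) form set" where
  "poly_forms v n r k =
     (if k \<in> {0..int n}
      then form.span {form_mult (bary_power v n \<alpha>) (dbary v n \<sigma>) | \<alpha> \<sigma>.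
             \<alpha> \<in> multiindices (int r) n \<and> \<sigma> \<in> inc_maps (nat k) n}
      else {0})"

definition poly_forms_minus ::
    "(nat \<Rightarrow> 'a::euclidean_space) \<Rightarrow> nat \<Rightarrow> nat \<Rightarrow> int \<Rightarrow> ('a, 'f::real_normed_field) form set" where
  "poly_forms_minus v n r k =
     (if k \<in> {0..int n}
      then form.span {form_mult (bary_power v n \<alpha>) (whitney v n \<rho>) | \<alpha> \<rho>.
             \<alpha> \<in> multiindices (int r - 1) n \<and> \<rho> \<in> inc_maps0 (nat k) n}
      else {0})"

definition vanishing_trace ::
    "(nat \<Rightarrow> 'a::euclidean_space) \<Rightarrow> nat \<Rightarrow> ('a, 'f::real_normed_field) form \<Rightarrow> bool" where
  "vanishing_trace v n \<omega> \<longleftrightarrow>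
     (\<forall>K. K \<subset> {..n} \<and> K \<noteq> {} \<longrightarrow> pullback (convex hull (v ` K)) id \<omega> = 0)"

definition poly_forms0 ::
    "(nat \<Rightarrow> 'a::euclidean_space) \<Rightarrow> nat \<Rightarrow> nat \<Rightarrow> int \<Rightarrow> ('a, 'f::real_normed_field) form set" where
  "poly_forms0 v n r k = {\<omega> \<in> poly_forms v n r k. vanishing_trace v n \<omega>}"

definition poly_forms_minus0 ::
    "(nat \<Rightarrow> 'a::euclidean_space) \<Rightarrow> nat \<Rightarrow> nat \<Rightarrow> int \<Rightarrow> ('a, 'f::real_normed_field) form set" where
  "poly_forms_minus0 v n r k = {\<omega> \<in> poly_forms_minus v n r k. vanishing_trace v n \<omega>}"


section \<open>The canonical isomorphisms\<close>

definition form_iso ::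
    "('a, 'f::real_normed_field) form set \<Rightarrow> ('a, 'f) form set
      \<Rightarrow> (('a, 'f) form \<Rightarrow> ('a, 'f) form) \<Rightarrow> bool" where
  "form_iso X Y L \<longleftrightarrow> bij_betw L X Y \<and>
     (\<forall>\<omega>\<in>X. \<forall>\<eta>\<in>X. L (\<omega> + \<eta>) = L \<omega> + L \<eta>) \<and>
     (\<forall>c. \<forall>\<omega>\<in>X. L (form_scale c \<omega>) = form_scale c (L \<omega>))"

text \<open>
  The values on a spanning set determine the isomorphism uniquely on its domain; outside of the
  domain it is unconstrained.
\<close>

definition canonical_iso_I ::
    "(nat \<Rightarrow> 'a::euclidean_space) \<Rightarrow> nat \<Rightarrow> nat \<Rightarrow> nat
      \<Rightarrow> (('a, 'f::real_normed_field) form \<Rightarrow> ('a, 'f) form) \<Rightarrow> bool" where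
  "canonical_iso_I v n k r I \<longleftrightarrow>
     form_iso (poly_forms v n r (int k)) (poly_forms_minus0 v n (r + k + 1) (int n - int k)) I \<and>
     (\<forall>\<alpha>\<in>multiindices (int r) n. \<forall>\<sigma>\<in>inc_maps k n.
        I (form_mult (bary_power v n \<alpha>) (dbary v n \<sigma>)) =
        form_scale (of_int (sort_sign (\<sigma> @ compl_map n \<sigma>)))
          (form_mult (bary_power v n \<alpha>)
            (form_mult (bary_prod v n \<sigma>) (whitney v n (compl_map n \<sigma>)))))"

definition canonical_iso_J ::
    "(nat \<Rightarrow> 'a::euclidean_space) \<Rightarrow> nat \<Rightarrow> nat \<Rightarrow> nat
      \<Rightarrow> (('a, 'f::real_normed_field) form \<Rightarrow> ('a, 'f) form) \<Rightarrow> bool" where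
  "canonical_iso_J v n k r J \<longleftrightarrow>
     form_iso (poly_forms_minus v n (r + 1) (int k)) (poly_forms0 v n (r + k + 1) (int n - int k)) J \<and>
     (\<forall>\<alpha>\<in>multiindices (int r) n. \<forall>\<rho>\<in>inc_maps0 k n.
        J (form_mult (bary_power v n \<alpha>) (whitney v n \<rho>)) =
        form_scale (of_int (sort_sign (compl_map n \<rho> @ \<rho>)))
          (form_mult (bary_power v n \<alpha>)
            (form_mult (bary_prod v n \<rho>) (dbary v n (compl_map n \<rho>)))))"

end

theory Submission imports Defs begin

text \<open>
  Write \<open>P\<close> for the pullback along \<open>S\<^sub>\<pi>\<close>. The canonical isomorphisms commute with \<open>P\<close> up to the sign
  of \<open>\<pi>\<close>, so they carry a permutation of \<open>Q\<close> up to unimodular factors to one of the image, and back.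
  On generators this is seen by dropping the requirement that the index lists be increasing:
  \<open>d\<lambda>\<^sub>\<sigma>\<close>, \<open>\<phi>\<^sub>\<rho>\<close> and the sorting sign all change sign when two neighbouring entries are exchanged, so
  that \<open>I (\<lambda>\<^sup>\<alpha> d\<lambda>\<^sub>\<sigma>) = \<epsilon>(\<sigma>, \<tau>) \<lambda>\<^sup>\<alpha> \<lambda>\<^sub>\<sigma> \<phi>\<^sub>\<tau>\<close> holds for every arrangement \<open>\<sigma>, \<tau>\<close> of
  \<open>0, \<dots>, n\<close>, and likewise for \<open>J\<close>. Since \<open>P\<close> just applies \<open>\<pi>\<close> to all indices, only the constant factor
  between \<open>\<epsilon>(\<pi> \<sigma>, \<pi> \<tau>)\<close> and \<open>\<epsilon>(\<sigma>, \<tau>)\<close> remains.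
\<close>

section \<open>Sorting signs\<close>

text \<open>The definite description in \<open>sort_sign\<close> is justified here: every sorting
  permutation yields the same list \<open>sort xs\<close>, and since the entries are distinct, equal
  entries at position \<open>i\<close> force equal indices.\<close>

lemma sort_sign_eq:
  assumes "distinct xs" "p permutes {..<length xs}" "sorted (permute_list p xs)"
  shows "sort_sign xs = sign p"
proof -
  have "q = p" if q: "q permutes {..<length xs}" "sorted (permute_list q xs)" for q
  proof
    fix i
    have "sort xs = permute_list p xs" "sort xs = permute_list q xs"
      by (rule properties_for_sort; simp add: assms q)+
    then have eq: "permute_list q xs = permute_list p xs" by simp
    show "q i = p i"
    proof (cases "i < length xs")
      case True
      have "xs ! q i = xs ! p i"
        using arg_cong[OF eq, of "\<lambda>l. l ! i"] True q(1) assms(2) by (simp add: permute_list_nth)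
      moreover have "q i < length xs" "p i < length xs"
        using permutes_in_image[OF q(1), of i] permutes_in_image[OF assms(2), of i] True by auto
      ultimately show ?thesis using assms(1) nth_eq_iff_index_eq by blast
    next
      case False
      then show ?thesis using q(1) assms(2) by (simp add: permutes_def)
    qed
  qed
  then have "(THE p. p permutes {..<length xs} \<and> sorted (permute_list p xs)) = p"
    using assms(2,3) by (intro the_equality) blast+
  then show ?thesis by (simp add: sort_sign_def)
qed

lemma sort_sign_perm:
  assumes "distinct xs"
  obtains p where "p permutes {..<length xs}" "permute_list p xs = sort xs" "sort_sign xs = sign p"
proof -
  have "mset (sort xs) = mset xs" by simp
  then obtain p where p: "p permutes {..<length xs}" "permute_list p xs = sort xs"
    by (rule mset_eq_permutation)
  then have "sorted (permute_list p xs)" by (simp only: sorted_sort)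
  then show ?thesis using that p sort_sign_eq[OF assms] by blast
qed

lemma sort_sign_square:
  assumes "distinct xs"
  shows "sort_sign xs * sort_sign xs = 1"
  by (rule sort_sign_perm[OF assms]) (simp add: sign_idempotent)

lemma norm_sort_sign:
  assumes "distinct xs"
  shows "norm (of_int (sort_sign xs) :: 'f::real_normed_field) = 1"
  by (rule sort_sign_perm[OF assms]) (simp add: sign_def)

lemma sort_sign_sorted:
  assumes "distinct xs" "sorted xs"
  shows "sort_sign xs = 1"
  using sort_sign_eq[OF assms(1) permutes_id] assms(2) by simp

lemma nth_adjacent_swap:
  assumes "i < length (a @ x # y # b)"
  shows "(a @ y # x # b) ! i = (a @ x # y # b) ! Transposition.transpose (length a) (Suc (length a)) i"
proof -
  consider "i < length a" | "i = length a" | "i = Suc (length a)" | "i > Suc (length a)"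
    by linarith
  then show ?thesis
  proof cases
    case 4
    then obtain j where "i = Suc (Suc (length a + j))"
      by (metis add_Suc less_iff_Suc_add)
    then show ?thesis by (simp add: nth_append Transposition.transpose_def)
  qed (auto simp: nth_append Transposition.transpose_def)
qed

lemma transpose_permutes_adjacent:
  "Transposition.transpose (length a) (Suc (length a)) permutes {..<length (a @ x # y # b)}"
  by (intro permutes_swap_id) auto

text \<open>If \<open>p\<close> sorts the first list, then the transposition of the two positions
  composed with \<open>p\<close> sorts the second one, and this transposition is odd.\<close>

lemma sort_sign_adjacent_swap:
  assumes "distinct (a @ x # y # b)"
  shows "sort_sign (a @ x # y # b) = - sort_sign (a @ y # x # b)"
proof -
  let ?xs = "a @ x # y # b" and ?ys = "a @ y # x # b"
  let ?t = "Transposition.transpose (length a) (Suc (length a))"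
  have dys: "distinct ?ys" using assms by auto
  obtain p where p: "p permutes {..<length ?xs}" "permute_list p ?xs = sort ?xs"
      "sort_sign ?xs = sign p"
    using sort_sign_perm[OF assms] .
  have tp: "?t permutes {..<length ?ys}" by (rule transpose_permutes_adjacent)
  have xs: "permute_list ?t ?ys = ?xs"
    using nth_adjacent_swap[of _ a y x b] permute_list_nth[OF tp]
    by (intro nth_equalityI) auto
  have "permute_list (?t \<circ> p) ?ys = sort ?xs"
    using permute_list_compose[of p ?ys ?t] p(1,2) xs by simp
  moreover have "?t \<circ> p permutes {..<length ?ys}"
    using permutes_compose[OF _ tp] p(1) by simp
  moreover have "sorted (sort ?xs)" by (rule sorted_sort)
  ultimately have "sort_sign ?ys = sign (?t \<circ> p)"
    by (intro sort_sign_eq[OF dys]) (simp_all only:)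
  also have "\<dots> = sign ?t * sign p"
    using p(1) tp by (intro sign_compose permutation_permutes[THEN iffD2]) blast+
  also have "sign ?t = - 1" by (simp only: sign_swap_id split: if_split) simp
  finally show ?thesis using p(3) by linarith
qed

text \<open>Insertion moves \<open>x\<close> to the right by exchanges of neighbours, each passed
  entry joining the prefix \<open>a\<close>. Invariance is assumed only on rearrangements of one
  multiset \<open>M\<close>, because sign laws will be available only for distinct entries.\<close>

lemma adjacent_swap_invariant_insort:
  assumes "\<And>a x y b. mset (a @ x # y # b) = M \<Longrightarrow> g (a @ x # y # b) = g (a @ y # x # b)"
    and "mset (a @ x # ys) = M"
  shows "g (a @ x # ys) = g (a @ insort x ys)"
  using assms(2)
proof (induction ys arbitrary: a)
  case (Cons y ys)
  show ?case
  proof (cases "x \<le> y")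
    case False
    have "g (a @ x # y # ys) = g ((a @ [y]) @ x # ys)"
      using assms(1)[OF Cons.prems] by simp
    also have "\<dots> = g ((a @ [y]) @ insort x ys)"
      using Cons.prems by (intro Cons.IH) (simp add: add_mset_commute)
    finally show ?thesis using False by simp
  qed simp
qed simp

lemma adjacent_swap_invariant_sort:
  assumes "\<And>a x y b. mset (a @ x # y # b) = M \<Longrightarrow> g (a @ x # y # b) = g (a @ y # x # b)"
    and "mset (a @ xs) = M"
  shows "g (a @ xs) = g (a @ sort xs)"
  using assms(2)
proof (induction xs arbitrary: a)
  case (Cons x xs)
  have "g (a @ x # xs) = g (a @ x # sort xs)"
    using Cons.IH[of "a @ [x]"] Cons.prems by simp
  also have "\<dots> = g (a @ insort x (sort xs))"
    by (rule adjacent_swap_invariant_insort[of M]) (use assms(1) Cons.prems in simp_all)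
  finally show ?case by simp
qed simp

text \<open>Multiplication by \<open>sort_sign\<close> turns an alternating function into one that
  is invariant under exchanges of neighbours, so insertion sort does not change it. The sorted list
  has sign 1, and every sign is its own inverse.\<close>

lemma alternating_sort:
  fixes f :: "nat list \<Rightarrow> 'b::ring_1"
  assumes "distinct xs"
    and "\<And>a x y b. mset (a @ x # y # b) = mset xs \<Longrightarrow> f (a @ x # y # b) = - f (a @ y # x # b)"
  shows "f xs = of_int (sort_sign xs) * f (sort xs)"
proof -
  let ?g = "\<lambda>ys. of_int (sort_sign ys) * f ys"
  have "?g (a @ x # y # b) = ?g (a @ y # x # b)" if "mset (a @ x # y # b) = mset xs" for a x y b
    using assms(2)[OF that] sort_sign_adjacent_swap[of a x y b]
      mset_eq_imp_distinct_iff[OF that] assms(1) by simp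
  from adjacent_swap_invariant_sort[of "mset xs" ?g "[]" xs, OF this]
  have "?g xs = ?g (sort xs)" by simp
  also have "\<dots> = f (sort xs)" using sort_sign_sorted[of "sort xs"] assms(1) by simp
  finally have "of_int (sort_sign xs * sort_sign xs) * f xs = of_int (sort_sign xs) * f (sort xs)"
    by (simp add: mult.assoc)
  then show ?thesis using sort_sign_square[OF assms(1)] by simp
qed

text \<open>The sign of a concatenation is itself alternating in each block, so the sorting law for
  alternating functions applies to the two blocks in turn.\<close>

lemma sort_sign_append:
  assumes "distinct (xs @ ys)"
  shows "sort_sign (xs @ ys) = sort_sign xs * sort_sign ys * sort_sign (sort xs @ sort ys)"
proof -
  have "sort_sign (xs @ ys) = of_int (sort_sign xs) * sort_sign (sort xs @ ys)"
  proof (rule alternating_sort)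
    fix a x y b assume "mset (a @ x # y # b) = mset xs"
    then have "mset ((a @ x # y # b) @ ys) = mset (xs @ ys)" by (simp only: mset_append)
    then have "mset (a @ x # y # (b @ ys)) = mset (xs @ ys)" by (simp only: append_assoc append_Cons)
    then have "distinct (a @ x # y # (b @ ys))"
      using assms mset_eq_imp_distinct_iff by blast
    from sort_sign_adjacent_swap[OF this]
    show "sort_sign ((a @ x # y # b) @ ys) = - sort_sign ((a @ y # x # b) @ ys)" by simp
  qed (use assms in auto)
  moreover have "sort_sign (sort xs @ ys) = of_int (sort_sign ys) * sort_sign (sort xs @ sort ys)"
  proof (rule alternating_sort)
    fix a x y b assume "mset (a @ x # y # b) = mset ys"
    then have "mset ((sort xs @ a) @ x # y # b) = mset (xs @ ys)"
      by (simp only: mset_append mset_sort append_assoc)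
    then have "distinct ((sort xs @ a) @ x # y # b)"
      using assms mset_eq_imp_distinct_iff by blast
    from sort_sign_adjacent_swap[OF this]
    show "sort_sign (sort xs @ (a @ x # y # b)) = - sort_sign (sort xs @ (a @ y # x # b))" by simp
  qed (use assms in auto)
  ultimately show ?thesis by simp
qed

text \<open>As a function of \<open>xs\<close>, the sign of \<open>map \<pi> xs\<close> alternates.
  Sorting \<open>xs\<close> always gives \<open>0, ..., n\<close>, so the factor is the same for all
  arrangements: the sign of the value list of \<open>\<pi>\<close>.\<close>

lemma sort_sign_map_permutes:
  assumes perm: "\<pi> permutes {..n}" and "distinct xs" "set xs = {..n}"
  shows "sort_sign xs = sort_sign (map \<pi> [0..<Suc n]) * sort_sign (map \<pi> xs)"
proof -
  let ?s = "sort_sign (map \<pi> [0..<Suc n])"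
  have "sort_sign (map \<pi> xs) = of_int (sort_sign xs) * sort_sign (map \<pi> (sort xs))"
  proof (rule alternating_sort)
    fix a x y b assume "mset (a @ x # y # b) = mset xs"
    then have "distinct (a @ x # y # b)" using assms(2) mset_eq_imp_distinct_iff by blast
    then have "distinct (map \<pi> (a @ x # y # b))"
      using distinct_map permutes_inj_on[OF perm] by blast
    then show "sort_sign (map \<pi> (a @ x # y # b)) = - sort_sign (map \<pi> (a @ y # x # b))"
      using sort_sign_adjacent_swap[of "map \<pi> a" "\<pi> x" "\<pi> y" "map \<pi> b"] by simp
  qed (rule assms)
  moreover have "sort xs = [0..<Suc n]"
  proof (rule sorted_distinct_set_unique)
    show "set (sort xs) = set [0..<Suc n]"
      unfolding set_sort set_upt assms(3) by (simp only: atLeast0LessThan lessThan_Suc_atMost)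
  qed (simp_all only: sorted_sort distinct_sort assms(2) sorted_upt distinct_upt)
  ultimately have "sort_sign (map \<pi> xs) = sort_sign xs * ?s" by (simp only: of_int_eq_id id_apply)
  \<comment> \<open>The factor is a sign, so it can be moved to the other side of the
    equation.\<close>
  moreover have "?s * ?s = 1"
    using permutes_inj_on[OF perm] by (intro sort_sign_square) (simp only: distinct_map distinct_upt)
  ultimately show ?thesis by (metis mult.assoc mult.commute mult.right_neutral)
qed

section \<open>Alternating families of forms\<close>

lemma dir_deriv_affine:
  assumes "\<And>t. f (x + t *\<^sub>R w) = f x + t *\<^sub>R d"
  shows "dir_deriv f x w = d"
  unfolding dir_deriv_def assms
  by (rule vector_derivative_at) (auto intro!: derivative_eq_intros)

lemma form_mult_scale: "form_mult f (form_scale c \<omega>) = form_scale c (form_mult f \<omega>)"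
  by (simp add: form_mult_def form_scale_def mult_ac)

lemma form_mult_uminus: "form_mult f (- \<omega>) = - form_mult f \<omega>"
  by (simp add: form_mult_def fun_eq_iff)

lemma pullback_zero: "pullback T S 0 = 0"
  by (auto simp: pullback_def fun_eq_iff)

lemma pullback_add: "pullback T S (\<omega> + \<eta>) = pullback T S \<omega> + pullback T S \<eta>"
  by (auto simp: pullback_def fun_eq_iff)

lemma pullback_scale: "pullback T S (form_scale c \<omega>) = form_scale c (pullback T S \<omega>)"
  by (auto simp: pullback_def form_scale_def fun_eq_iff)

lemma pullback_sum: "pullback T S (sum f A) = (\<Sum>a\<in>A. pullback T S (f a))"
  by (induction A rule: infinite_finite_induct)
    (simp_all only: sum.infinite sum.empty sum.insert not_False_eq_True pullback_add pullback_zero)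

text \<open>Agreement on \<open>T\<close> suffices because a pullback vanishes at all other points.
  This matters since barycentric coordinates are meaningful only on the affine hull.\<close>

lemma pullback_form_mult_cong:
  assumes "\<And>x. x \<in> T \<Longrightarrow> f (S x) = g x"
  shows "pullback T S (form_mult f \<omega>) = form_mult g (pullback T S \<omega>)"
  using assms by (auto simp: pullback_def form_mult_def fun_eq_iff)

text \<open>This is the row exchange rule for determinants: composing the summation permutation with
  the transposition on the right flips its sign and only reorders the factors.\<close>

lemma wedge_adjacent_swap:
  "wedge T (a @ x # y # b) = - wedge T (a @ y # x # b)"
proof (intro ext)
  fix z vs
  let ?t = "Transposition.transpose (length a) (Suc (length a))"
  let ?xs = "a @ x # y # b" and ?ys = "a @ y # x # b"
  let ?I = "{..<length ?xs}"
  have t: "?t permutes ?I" by (rule transpose_permutes_adjacent)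
  have "(\<Sum>p | p permutes ?I. of_int (sign p) * (\<Prod>i\<in>?I. (?ys ! i) z [vs ! p i]))
      = (\<Sum>p | p permutes ?I. of_int (sign (p \<circ> ?t)) * (\<Prod>i\<in>?I. (?ys ! i) z [vs ! (p \<circ> ?t) i]))"
    by (rule sum_permutations_compose_right[OF t])
  also have "\<dots> = (\<Sum>p | p permutes ?I. - (of_int (sign p) * (\<Prod>i\<in>?I. (?xs ! i) z [vs ! p i])))"
  proof (rule sum.cong)
    fix p assume "p \<in> {p. p permutes ?I}"
    then have p: "p permutes ?I" by simp
    have "sign (p \<circ> ?t) = sign p * sign ?t"
      using p t by (intro sign_compose permutation_permutes[THEN iffD2]) blast+
    moreover have "(\<Prod>i\<in>?I. (?ys ! i) z [vs ! (p \<circ> ?t) i]) = (\<Prod>i\<in>?I. (?xs ! i) z [vs ! p i])"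
    proof -
      have "(\<Prod>i\<in>?I. (?ys ! i) z [vs ! (p \<circ> ?t) i])
          = (\<Prod>i\<in>?I. ((\<lambda>i. (?xs ! i) z [vs ! p i]) \<circ> ?t) i)"
        by (rule prod.cong) (simp_all add: nth_adjacent_swap)
      also have "\<dots> = (\<Prod>i\<in>?I. (?xs ! i) z [vs ! p i])"
        using prod.permute[OF t, of "\<lambda>i. (?xs ! i) z [vs ! p i]"] by simp
      finally show ?thesis .
    qed
    ultimately show "of_int (sign (p \<circ> ?t)) * (\<Prod>i\<in>?I. (?ys ! i) z [vs ! (p \<circ> ?t) i])
        = - (of_int (sign p) * (\<Prod>i\<in>?I. (?xs ! i) z [vs ! p i]))"
      by (simp add: sign_swap_id)
  qed simp
  finally show "wedge T ?xs z vs = (- wedge T ?ys) z vs"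
    by (simp add: wedge_def sum_negf)
qed

lemma dbary_adjacent_swap: "dbary v n (a @ x # y # b) = - dbary v n (a @ y # x # b)"
  unfolding dbary_def by (simp add: wedge_adjacent_swap[where x = "ext_deriv _ (bary v n x)"])

lemma whitney_adjacent_swap:
  fixes v :: "nat \<Rightarrow> 'a::euclidean_space"
  shows "(whitney v n (a @ x # y # b) :: ('a, 'f::real_normed_field) form) =
    - whitney v n (a @ y # x # b)"
proof -
  let ?t = "Transposition.transpose (length a) (Suc (length a))"
  let ?xs = "a @ x # y # b" and ?ys = "a @ y # x # b"
  let ?I = "{..<length ?xs}"
  define F :: "nat list \<Rightarrow> nat \<Rightarrow> ('a, 'f) form" where "F xs i = form_scale ((- 1) ^ i)
      (form_mult (bary v n (xs ! i)) (dbary v n (take i xs @ drop (Suc i) xs)))" for xs i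
  have t: "?t permutes ?I" by (rule transpose_permutes_adjacent)
  \<comment> \<open>The summands are matched by the entry that they delete, whose position moves by
    the transposition.\<close>
  have "F ?ys i = - F ?xs (?t i)" if "i < length ?xs" for i
  proof -
    consider "i < length a" | "i = length a" | "i = Suc (length a)" | "i > Suc (length a)"
      by linarith
    then show ?thesis
    proof cases
      case 1
      have split: "take i (a @ z) @ drop (Suc i) (a @ z) = (take i a @ drop (Suc i) a) @ z" for z
        using 1 by simp
      have "?ys ! i = ?xs ! ?t i" "?t i = i"
        using 1 by (simp_all add: Transposition.transpose_def nth_append)
      \<comment> \<open>Deleting an entry before the swapped pair leaves the pair adjacent, so the
        sign comes from the wedge product; the same happens for an entry behind the pair.\<close>
      moreover have "(dbary v n (take i ?ys @ drop (Suc i) ?ys) :: ('a, 'f) form) =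
          - dbary v n (take i ?xs @ drop (Suc i) ?xs)"
        unfolding split by (rule dbary_adjacent_swap)
      ultimately show ?thesis by (simp only: F_def form_mult_uminus form.scale_minus_right)
    next
      case 4
      then obtain j where j: "i = Suc (Suc (length a + j))"
        by (metis add_Suc less_iff_Suc_add)
      have split: "take i (a @ p # q # b) @ drop (Suc i) (a @ p # q # b) =
          a @ p # q # (take j b @ drop (Suc j) b)" for p q
        by (simp add: j numeral_3_eq_3)
      have "?ys ! i = ?xs ! ?t i" "?t i = i"
        using 4 by (simp_all add: j Transposition.transpose_def nth_append)
      moreover have "(dbary v n (take i ?ys @ drop (Suc i) ?ys) :: ('a, 'f) form) =
          - dbary v n (take i ?xs @ drop (Suc i) ?xs)"
        unfolding split by (rule dbary_adjacent_swap)
      ultimately show ?thesis by (simp only: F_def form_mult_uminus form.scale_minus_right)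
    \<comment> \<open>When one of the swapped entries is deleted, the same wedge product remains on
      both sides; the sign comes from \<open>(-1) ^ i\<close>, as the deleted position shifts by
      one.\<close>
    qed (auto simp: F_def Transposition.transpose_def nth_append fun_eq_iff form_scale_def form_mult_def)
  qed
  then have "(\<Sum>i\<in>?I. F ?ys i) = (\<Sum>i\<in>?I. - F ?xs (?t i))"
    by (intro sum.cong refl) (simp only: lessThan_iff)
  also have "\<dots> = - (\<Sum>i\<in>?I. F ?xs (?t i))"
    by (rule sum_negf)
  also have "(\<Sum>i\<in>?I. F ?xs (?t i)) = (\<Sum>i\<in>?I. F ?xs i)"
    using sum.permute[OF t, of "F ?xs"] by (simp only: comp_def)
  finally have "(\<Sum>i\<in>?I. F ?ys i) = - (\<Sum>i\<in>?I. F ?xs i)" .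
  moreover have "?I = {..<length ?ys}" by simp
  moreover have "whitney v n zs = (\<Sum>i<length zs. F zs i)" for zs :: "nat list"
    by (simp only: whitney_def F_def)
  ultimately have "(whitney v n ?ys :: ('a, 'f) form) = - whitney v n ?xs" by (simp only:)
  then show ?thesis by (simp only: minus_minus)
qed

text \<open>The sorting law is applied to the values at each point and each list of vectors.\<close>

lemma alternating_form_sort:
  fixes A :: "nat list \<Rightarrow> ('a, 'f::real_normed_field) form"
  assumes "\<And>a x y b. A (a @ x # y # b) = - A (a @ y # x # b)" "distinct xs"
  shows "A xs = form_scale (of_int (sort_sign xs)) (A (sort xs))"
proof (intro ext)
  fix z vs
  have "A xs z vs = of_int (sort_sign xs) * A (sort xs) z vs"
    by (rule alternating_sort[where f = "\<lambda>xs. A xs z vs", OF assms(2)]) (subst assms(1), simp)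
  then show "A xs z vs = form_scale (of_int (sort_sign xs)) (A (sort xs)) z vs"
    by (simp add: form_scale_def)
qed

lemmas dbary_sort = alternating_form_sort[of "dbary v n" for v n, OF dbary_adjacent_swap]
lemmas whitney_sort = alternating_form_sort[of "whitney v n" for v n, OF whitney_adjacent_swap]

section \<open>Arrangements of the indices and increasing maps\<close>

lemma sort_in_inc_maps:
  assumes "distinct \<sigma>" "length \<sigma> = m" "set \<sigma> \<subseteq> {..n}"
  shows "sort \<sigma> \<in> inc_maps m n"
  using assms sorted_sort[of \<sigma>] by (simp add: inc_maps_def strict_sorted_iff)

text \<open>This replaces the complement in the formulas for the isomorphisms by the second block of
  an arbitrary arrangement.\<close>

lemma compl_map_sort:
  assumes "distinct (\<sigma> @ \<tau>)" "set (\<sigma> @ \<tau>) = {..n}"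
  shows "compl_map n (sort \<sigma>) = sort \<tau>"
proof -
  have "{..n} - set (sort \<sigma>) = set \<tau>" using assms by auto
  then show ?thesis
    using assms(1) by (simp add: compl_map_def sorted_list_of_set_sort_remdups distinct_remdups_id)
qed

section \<open>Barycentric coordinates and their symmetries\<close>

locale simplex =
  fixes v :: "nat \<Rightarrow> 'a::euclidean_space" and n :: nat
  assumes vertices: "simplex_vertices v n"
begin

abbreviation "T \<equiv> simplex_of v n"

lemma inj_vertices: "inj_on v {..n}"
  using vertices by (simp add: simplex_vertices_def)

text \<open>Affine dependence is stated with coefficients on points, so the coefficients are carried
  from indices to points by the inverse of \<open>v\<close>.\<close>

lemma coeffs_eq_0:
  assumes "sum u {..n} = 0" "(\<Sum>j\<le>n. u j *\<^sub>R v j) = 0" "i \<le> n"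
  shows "u i = (0::real)"
proof (rule ccontr)
  assume "u i \<noteq> 0"
  let ?U = "\<lambda>y. u (the_inv_into {..n} v y)"
  have inv: "the_inv_into {..n} v (v j) = j" if "j \<le> n" for j
    using that inj_vertices by (simp add: the_inv_into_f_f)
  have "sum ?U (v ` {..n}) = 0" "(\<Sum>y\<in>v ` {..n}. ?U y *\<^sub>R y) = 0" "?U (v i) \<noteq> 0"
    using assms inv \<open>u i \<noteq> 0\<close> by (simp_all add: sum.reindex[OF inj_vertices])
  then have "affine_dependent (v ` {..n})"
    using assms(3) affine_dependent_explicit_finite[of "v ` {..n}"] by blast
  then show False using vertices by (simp add: simplex_vertices_def)
qed

lemma bary_combination:
  assumes "sum u {..n} = 1" "i \<le> n"
  shows "bary v n i (\<Sum>j\<le>n. u j *\<^sub>R v j) = u i"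
proof -
  \<comment> \<open>The description in \<open>bary\<close> demands zero coefficients beyond
    \<open>n\<close>, hence the truncation of \<open>u\<close>.\<close>
  let ?u = "\<lambda>j. if j \<le> n then u j else 0"
  have "(THE w. (\<forall>j>n. w j = 0) \<and> sum w {..n} = 1 \<and> (\<Sum>j\<le>n. w j *\<^sub>R v j) = (\<Sum>j\<le>n. u j *\<^sub>R v j)) = ?u"
  proof (rule the_equality)
    fix w :: "nat \<Rightarrow> real"
    assume w: "(\<forall>j>n. w j = 0) \<and> sum w {..n} = 1 \<and> (\<Sum>j\<le>n. w j *\<^sub>R v j) = (\<Sum>j\<le>n. u j *\<^sub>R v j)"
    have "w j - u j = 0" if "j \<le> n" for j
      by (rule coeffs_eq_0[of "\<lambda>j. w j - u j"])
        (use w assms that in \<open>auto simp: sum_subtractf scaleR_diff_left\<close>)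
    then show "w = ?u" using w by (auto simp: fun_eq_iff)
  qed (use assms in auto)
  then show ?thesis using assms(2) by (simp add: bary_def)
qed

lemma affine_hull_vertices:
  assumes "x \<in> affine hull (v ` {..n})"
  shows "(\<Sum>j\<le>n. bary v n j x) = 1" "(\<Sum>j\<le>n. bary v n j x *\<^sub>R v j) = x"
proof -
  obtain u where "sum u (v ` {..n}) = 1" "(\<Sum>y\<in>v ` {..n}. u y *\<^sub>R y) = x"
    using assms by (auto simp: affine_hull_finite)
  then have u: "sum (u \<circ> v) {..n} = 1" "x = (\<Sum>j\<le>n. (u \<circ> v) j *\<^sub>R v j)"
    by (simp_all add: sum.reindex[OF inj_vertices])
  then have "bary v n j x = (u \<circ> v) j" if "j \<le> n" for j
    using bary_combination[of "u \<circ> v" j] that by blast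
  then show "(\<Sum>j\<le>n. bary v n j x) = 1" "(\<Sum>j\<le>n. bary v n j x *\<^sub>R v j) = x"
    using u by simp_all
qed

lemma combination_in_affine_hull:
  assumes "sum u {..n} = 1"
  shows "(\<Sum>j\<le>n. u j *\<^sub>R v j) \<in> affine hull (v ` {..n})"
proof -
  let ?U = "\<lambda>y. u (the_inv_into {..n} v y)"
  have "sum ?U (v ` {..n}) = 1" "(\<Sum>y\<in>v ` {..n}. ?U y *\<^sub>R y) = (\<Sum>j\<le>n. u j *\<^sub>R v j)"
    using assms by (simp_all add: sum.reindex[OF inj_vertices] the_inv_into_f_f[OF inj_vertices])
  then show ?thesis by (auto simp: affine_hull_finite)
qed

lemma affine_hull_T: "affine hull T = affine hull (v ` {..n})"
  by (simp add: simplex_of_def)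

lemma T_subset: "x \<in> T \<Longrightarrow> x \<in> affine hull (v ` {..n})"
  using convex_hull_subset_affine_hull by (auto simp: simplex_of_def)

text \<open>With this description, invariance of \<open>T\<close> under a symmetry reduces to
  permuting nonnegative coordinates.\<close>

lemma T_iff: "x \<in> T \<longleftrightarrow> x \<in> affine hull (v ` {..n}) \<and> (\<forall>i\<le>n. bary v n i x \<ge> 0)"
proof
  assume x: "x \<in> T"
  obtain u where "\<forall>y\<in>v ` {..n}. 0 \<le> u y" "sum u (v ` {..n}) = 1" "(\<Sum>y\<in>v ` {..n}. u y *\<^sub>R y) = x"
    using x by (auto simp: simplex_of_def convex_hull_finite)
  then have u: "sum (u \<circ> v) {..n} = 1" "x = (\<Sum>j\<le>n. (u \<circ> v) j *\<^sub>R v j)" "\<forall>j\<le>n. (u \<circ> v) j \<ge> 0"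
    by (simp_all add: sum.reindex[OF inj_vertices])
  then have "bary v n j x = (u \<circ> v) j" if "j \<le> n" for j
    using bary_combination[of "u \<circ> v" j] that by blast
  then show "x \<in> affine hull (v ` {..n}) \<and> (\<forall>i\<le>n. bary v n i x \<ge> 0)"
    using T_subset[OF x] u(3) by simp
next
  assume x: "x \<in> affine hull (v ` {..n}) \<and> (\<forall>i\<le>n. bary v n i x \<ge> 0)"
  have "(\<Sum>j\<le>n. bary v n j x *\<^sub>R v j) \<in> T"
    unfolding simplex_of_def
    by (rule convex_sum) (use x affine_hull_vertices in \<open>auto intro: hull_inc\<close>)
  then show "x \<in> T" using x affine_hull_vertices by simp
qed

lemma tangent_spaceD:
  assumes "w \<in> tangent_space T"
  obtains b where "sum b {..n} = 0" "w = (\<Sum>j\<le>n. b j *\<^sub>R v j)"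
proof -
  obtain y z where w: "w = y - z" "y \<in> affine hull (v ` {..n})" "z \<in> affine hull (v ` {..n})"
    using assms by (auto simp: tangent_space_def affine_hull_T)
  show ?thesis
    by (rule that[of "\<lambda>j. bary v n j y - bary v n j z"])
      (use w affine_hull_vertices in \<open>simp_all add: sum_subtractf scaleR_diff_left\<close>)
qed

lemma tangent_spaceI:
  assumes "sum b {..n} = 0"
  shows "(\<Sum>j\<le>n. b j *\<^sub>R v j) \<in> tangent_space T"
proof -
  \<comment> \<open>The coefficients of the base point \<open>v 0\<close>: the vector is the
    difference of a shifted point of the affine hull and \<open>v 0\<close>.\<close>
  let ?e = "\<lambda>j. if j = 0 then 1 else 0 :: real"
  have e: "sum ?e {..n} = 1" by (simp add: sum.delta)
  have "(\<Sum>j\<le>n. (?e j + b j) *\<^sub>R v j) \<in> affine hull T" "(\<Sum>j\<le>n. ?e j *\<^sub>R v j) \<in> affine hull T"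
    unfolding affine_hull_T
    by (intro combination_in_affine_hull; use e assms in \<open>simp add: sum.distrib\<close>)+
  moreover have "(\<Sum>j\<le>n. b j *\<^sub>R v j) = (\<Sum>j\<le>n. (?e j + b j) *\<^sub>R v j) - (\<Sum>j\<le>n. ?e j *\<^sub>R v j)"
    by (simp add: scaleR_add_left sum.distrib)
  ultimately show ?thesis unfolding tangent_space_def by blast
qed

text \<open>A line in a tangent direction may leave \<open>T\<close> but stays in its affine hull,
  where the coordinates are affine functions. All directional derivatives below come from
  this.\<close>

lemma bary_add_tangent:
  assumes "x \<in> affine hull (v ` {..n})" "sum b {..n} = 0" "i \<le> n"
  shows "bary v n i (x + t *\<^sub>R (\<Sum>j\<le>n. b j *\<^sub>R v j)) = bary v n i x + t * b i"
proof -
  have "x + t *\<^sub>R (\<Sum>j\<le>n. b j *\<^sub>R v j) = (\<Sum>j\<le>n. bary v n j x *\<^sub>R v j) + t *\<^sub>R (\<Sum>j\<le>n. b j *\<^sub>R v j)"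
    using affine_hull_vertices(2)[OF assms(1)] by simp
  also have "\<dots> = (\<Sum>j\<le>n. (bary v n j x + t * b j) *\<^sub>R v j)"
    by (simp add: scaleR_sum_right scaleR_add_left sum.distrib)
  also have "bary v n i \<dots> = bary v n i x + t * b i"
    using assms affine_hull_vertices(1)[OF assms(1)]
    by (intro bary_combination) (simp_all add: sum.distrib flip: sum_distrib_left)
  finally show ?thesis .
qed

lemma dir_deriv_bary:
  assumes "x \<in> affine hull (v ` {..n})" "sum b {..n} = 0" "i \<le> n"
  shows "dir_deriv (bary v n i) x (\<Sum>j\<le>n. b j *\<^sub>R v j) = b i"
  by (rule dir_deriv_affine) (simp add: bary_add_tangent[OF assms])

section \<open>The symmetry of a permutation and its pullback\<close>

context
  fixes \<pi> :: "nat \<Rightarrow> nat"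
  assumes perm: "\<pi> permutes {..n}"
begin

abbreviation "S \<equiv> simplex_sym v n \<pi>"
abbreviation "P \<equiv> pullback T S"

lemma perm_le: "\<pi> i \<le> n \<longleftrightarrow> i \<le> n"
  using permutes_in_image[OF perm, of i] by simp

lemma sum_perm: "(\<Sum>j\<le>n. f (\<pi> j)) = (\<Sum>j\<le>n. f j)"
  using sum.permute[OF perm, of f] by (simp add: comp_def)

text \<open>Reindexing the sum by \<open>\<pi>\<close> removes the inverse and exhibits the
  barycentric coordinates of the image point.\<close>

lemma S_eq: "S x = (\<Sum>j\<le>n. bary v n (\<pi> j) x *\<^sub>R v j)"
  using sum_perm[of "\<lambda>i. bary v n i x *\<^sub>R v (inv \<pi> i)"] permutes_inverses(2)[OF perm]
  by (simp add: simplex_sym_def)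

lemma bary_S:
  assumes "x \<in> affine hull (v ` {..n})" "i \<le> n"
  shows "bary v n i (S x) = bary v n (\<pi> i) x"
  unfolding S_eq
  by (rule bary_combination) (simp_all add: sum_perm[of "\<lambda>j. bary v n j x"] affine_hull_vertices(1) assms)

lemma S_in_T:
  assumes "x \<in> T"
  shows "S x \<in> T"
proof -
  have x: "x \<in> affine hull (v ` {..n})" using T_subset[OF assms] .
  have "S x \<in> affine hull (v ` {..n})"
    unfolding S_eq
    by (rule combination_in_affine_hull) (simp add: sum_perm[of "\<lambda>j. bary v n j x"] affine_hull_vertices(1)[OF x])
  then show ?thesis using assms x bary_S perm_le by (simp add: T_iff)
qed

lemma dir_deriv_S:
  assumes "x \<in> affine hull (v ` {..n})" "sum b {..n} = 0"
  shows "dir_deriv S x (\<Sum>j\<le>n. b j *\<^sub>R v j) = (\<Sum>j\<le>n. b (\<pi> j) *\<^sub>R v j)"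
  by (rule dir_deriv_affine)
    (simp only: S_eq, subst scaleR_sum_right,
      simp add: bary_add_tangent[OF assms] perm_le scaleR_add_left flip: sum.distrib)

text \<open>The derivative of \<open>S\<close> permutes the coefficients of a tangent vector just as
  \<open>S\<close> permutes barycentric coordinates; the second claim is the chain rule read off
  from these coefficients.\<close>

lemma dir_deriv_S_tangent:
  assumes "x \<in> T" "w \<in> tangent_space T"
  shows "dir_deriv S x w \<in> tangent_space T"
    and "i \<le> n \<Longrightarrow> dir_deriv (bary v n i) (S x) (dir_deriv S x w) = dir_deriv (bary v n (\<pi> i)) x w"
proof -
  obtain b where b: "sum b {..n} = 0" "w = (\<Sum>j\<le>n. b j *\<^sub>R v j)"
    using tangent_spaceD[OF assms(2)] .
  have b': "(\<Sum>j\<le>n. b (\<pi> j)) = 0" using b(1) sum_perm[of b] by simp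
  have x: "x \<in> affine hull (v ` {..n})" "S x \<in> affine hull (v ` {..n})"
    using T_subset assms(1) S_in_T by auto
  show "dir_deriv S x w \<in> tangent_space T"
    using tangent_spaceI[OF b'] dir_deriv_S[OF x(1) b(1)] b(2) by simp
  show "dir_deriv (bary v n i) (S x) (dir_deriv S x w) = dir_deriv (bary v n (\<pi> i)) x w" if "i \<le> n"
    using dir_deriv_bary[OF x(2) b'] dir_deriv_S[OF x(1) b(1)] dir_deriv_bary[OF x(1) b(1)] b(2) that perm_le
    by simp
qed

lemma pullback_dbary:
  assumes "set \<sigma> \<subseteq> {..n}"
  shows "P (dbary v n \<sigma>) = dbary v n (map \<pi> \<sigma>)"
proof (intro ext)
  fix x :: 'a and vs
  let ?k = "length \<sigma>"
  show "P (dbary v n \<sigma>) x vs = (dbary v n (map \<pi> \<sigma>) x vs :: 'b)"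
  proof (cases "x \<in> T \<and> length vs = ?k \<and> set vs \<subseteq> tangent_space T")
    case True
    let ?dvs = "map (dir_deriv S x) vs"
    have dvs: "set ?dvs \<subseteq> tangent_space T"
      using True dir_deriv_S_tangent(1) by auto
    have "ext_deriv T (bary v n (\<sigma> ! i)) (S x) [?dvs ! p i] =
        (ext_deriv T (bary v n (\<pi> (\<sigma> ! i))) x [vs ! p i] :: 'b)"
      if "p permutes {..<?k}" "i < ?k" for p i
    proof -
      have "p i < length vs" using permutes_in_image[OF that(1), of i] that(2) True by simp
      then have "vs ! p i \<in> tangent_space T" using True nth_mem by blast
      moreover have "\<sigma> ! i \<le> n" using assms that(2) nth_mem by fastforce
      ultimately show ?thesis
        using True \<open>p i < length vs\<close> S_in_T dir_deriv_S_tangent by (simp add: ext_deriv_def)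
    qed
    then show ?thesis
      using True S_in_T dvs by (simp add: pullback_def dbary_def wedge_def)
  qed (auto simp: pullback_def dbary_def wedge_def)
qed

lemma pullback_bary_mult:
  assumes "i \<le> n"
  shows "P (form_mult (bary v n i) \<omega>) = form_mult (bary v n (\<pi> i)) (P \<omega>)"
  by (rule pullback_form_mult_cong) (simp add: bary_S T_subset assms)

lemma pullback_whitney:
  assumes "set \<rho> \<subseteq> {..n}"
  shows "P (whitney v n \<rho>) = whitney v n (map \<pi> \<rho>)"
proof -
  have "P (form_mult (bary v n (\<rho> ! i)) (dbary v n (take i \<rho> @ drop (Suc i) \<rho>))) =
      form_mult (bary v n (map \<pi> \<rho> ! i)) (dbary v n (take i (map \<pi> \<rho>) @ drop (Suc i) (map \<pi> \<rho>)))"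
    if "i < length \<rho>" for i
  proof -
    have "\<rho> ! i \<le> n" using assms that nth_mem by fastforce
    moreover have "set (take i \<rho> @ drop (Suc i) \<rho>) \<subseteq> {..n}"
      using assms set_take_subset set_drop_subset by (metis Un_least set_append subset_trans)
    ultimately show ?thesis
      using that
      by (simp only: pullback_bary_mult pullback_dbary map_append take_map drop_map nth_map)
  qed
  then show ?thesis
    unfolding whitney_def pullback_sum pullback_scale length_map
    by (intro sum.cong arg_cong[where f = "form_scale _"]) (simp_all only: lessThan_iff)
qed

text \<open>Coordinate \<open>i\<close> becomes coordinate \<open>\<pi> i\<close>, so the exponent
  at \<open>j\<close> is the old one at \<open>inv \<pi> j\<close>.\<close>

lemma pullback_bary_power_mult:
  "P (form_mult (bary_power v n \<alpha>) \<omega>) = form_mult (bary_power v n (\<alpha> \<circ> inv \<pi>)) (P \<omega>)"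
proof (rule pullback_form_mult_cong)
  fix x assume "x \<in> T"
  then have "bary_power v n \<alpha> (S x) = (\<Prod>i\<le>n. bary v n (\<pi> i) x ^ \<alpha> i)"
    by (simp add: bary_power_def bary_S T_subset)
  also have "\<dots> = (\<Prod>i\<le>n. ((\<lambda>j. bary v n j x ^ \<alpha> (inv \<pi> j)) \<circ> \<pi>) i)"
    by (simp add: permutes_inverses(2)[OF perm])
  also have "\<dots> = bary_power v n (\<alpha> \<circ> inv \<pi>) x"
    using prod.permute[OF perm, of "\<lambda>j. bary v n j x ^ \<alpha> (inv \<pi> j)"] by (simp add: bary_power_def)
  finally show "bary_power v n \<alpha> (S x) = bary_power v n (\<alpha> \<circ> inv \<pi>) x" .
qed

lemma pullback_bary_prod_mult:
  assumes "set \<sigma> \<subseteq> {..n}"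
  shows "P (form_mult (bary_prod v n \<sigma>) \<omega>) = form_mult (bary_prod v n (map \<pi> \<sigma>)) (P \<omega>)"
proof (rule pullback_form_mult_cong)
  fix x assume "x \<in> T"
  then have "map (\<lambda>i. bary v n i (S x)) \<sigma> = map (\<lambda>i. bary v n (\<pi> i) x) \<sigma>"
    using assms by (intro map_cong refl bary_S T_subset) auto
  then show "bary_prod v n \<sigma> (S x) = bary_prod v n (map \<pi> \<sigma>) x"
    by (simp only: bary_prod_def map_map comp_def)
qed

lemma multiindices_perm:
  assumes "\<alpha> \<in> multiindices r n"
  shows "\<alpha> \<circ> inv \<pi> \<in> multiindices r n"
proof -
  have "sum (\<alpha> \<circ> inv \<pi>) {..n} = sum \<alpha> {..n}"
    using sum.permute[OF permutes_inv[OF perm], of \<alpha>] by (simp only:)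
  then show ?thesis
    using assms permutes_not_in[OF permutes_inv[OF perm]]
    by (simp add: multiindices_def del: of_nat_sum)
qed

text \<open>
  The roles of \<open>(A, B, E)\<close> are played by \<open>(d\<lambda>, \<phi>, \<epsilon>(\<sigma>, \<tau>))\<close> for \<open>I\<close> and by
  \<open>(\<phi>, d\<lambda>, \<epsilon>(\<tau>, \<sigma>))\<close> for \<open>J\<close>.
\<close>

lemma equivariant_on_span:
  fixes A B :: "nat list \<Rightarrow> ('a, 'f::real_normed_field) form"
    and E :: "nat list \<Rightarrow> nat list \<Rightarrow> int" and r :: int and m :: nat
  defines "X \<equiv> form.span {form_mult (bary_power v n \<alpha>) (A \<sigma>) | \<alpha> \<sigma>.
      \<alpha> \<in> multiindices r n \<and> \<sigma> \<in> inc_maps m n}"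
  assumes A_sort: "\<And>xs. distinct xs \<Longrightarrow> A xs = form_scale (of_int (sort_sign xs)) (A (sort xs))"
    and B_sort: "\<And>xs. distinct xs \<Longrightarrow> B xs = form_scale (of_int (sort_sign xs)) (B (sort xs))"
    and A_perm: "\<And>xs. set xs \<subseteq> {..n} \<Longrightarrow> P (A xs) = A (map \<pi> xs)"
    and B_perm: "\<And>xs. set xs \<subseteq> {..n} \<Longrightarrow> P (B xs) = B (map \<pi> xs)"
    and E_sort: "\<And>\<sigma> \<tau>. distinct (\<sigma> @ \<tau>) \<Longrightarrow>
      E \<sigma> \<tau> = sort_sign \<sigma> * sort_sign \<tau> * E (sort \<sigma>) (sort \<tau>)"
    and E_perm: "\<And>\<sigma> \<tau>. distinct (\<sigma> @ \<tau>) \<Longrightarrow> set (\<sigma> @ \<tau>) = {..n} \<Longrightarrow>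
      E \<sigma> \<tau> = c * E (map \<pi> \<sigma>) (map \<pi> \<tau>)"
    and L_add: "\<And>\<omega> \<eta>. \<omega> \<in> X \<Longrightarrow> \<eta> \<in> X \<Longrightarrow> L (\<omega> + \<eta>) = L \<omega> + L \<eta>"
    and L_scale: "\<And>a \<omega>. \<omega> \<in> X \<Longrightarrow> L (form_scale a \<omega>) = form_scale a (L \<omega>)"
    and L_gen: "\<And>\<alpha> \<sigma>. \<alpha> \<in> multiindices r n \<Longrightarrow> \<sigma> \<in> inc_maps m n \<Longrightarrow>
      L (form_mult (bary_power v n \<alpha>) (A \<sigma>)) =
        form_scale (of_int (E \<sigma> (compl_map n \<sigma>)))
          (form_mult (bary_power v n \<alpha>)
            (form_mult (bary_prod v n \<sigma>) (B (compl_map n \<sigma>))))"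
    and \<omega>: "\<omega> \<in> X"
  shows "P \<omega> \<in> X \<and> P (L \<omega>) = form_scale (of_int c) (L (P \<omega>))"
proof -
  \<comment> \<open>The formula for \<open>L\<close> is extended from increasing lists to all
    arrangements. The signs from sorting \<open>A\<close> and \<open>B\<close> combine with that of
    \<open>E\<close>.\<close>
  have gen: "form_mult (bary_power v n \<alpha>) (A \<sigma>) \<in> X \<and>
      L (form_mult (bary_power v n \<alpha>) (A \<sigma>)) = form_scale (of_int (E \<sigma> \<tau>))
        (form_mult (bary_power v n \<alpha>) (form_mult (bary_prod v n \<sigma>) (B \<tau>)))"
    if "\<alpha> \<in> multiindices r n" "distinct (\<sigma> @ \<tau>)" "set (\<sigma> @ \<tau>) = {..n}" "length \<sigma> = m" for \<alpha> \<sigma> \<tau>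
  proof -
    have d: "distinct \<sigma>" "distinct \<tau>" using that(2) by auto
    have inc: "sort \<sigma> \<in> inc_maps m n"
      by (rule sort_in_inc_maps) (use d that in auto)
    have sorted_in: "form_mult (bary_power v n \<alpha>) (A (sort \<sigma>)) \<in> X"
      unfolding X_def by (rule form.span_base) (use that(1) inc in blast)
    have A: "form_mult (bary_power v n \<alpha>) (A \<sigma>) =
        form_scale (of_int (sort_sign \<sigma>)) (form_mult (bary_power v n \<alpha>) (A (sort \<sigma>)))"
      by (subst A_sort[OF d(1)]) (rule form_mult_scale)
    have "mset (map (\<lambda>i. bary v n i x) (sort \<sigma>)) = mset (map (\<lambda>i. bary v n i x) \<sigma>)" for x
      by simp
    then have prod: "bary_prod v n (sort \<sigma>) = bary_prod v n \<sigma>"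
      unfolding bary_prod_def by (intro ext) (metis prod_mset_prod_list)
    have "L (form_mult (bary_power v n \<alpha>) (A \<sigma>)) =
        form_scale (of_int (sort_sign \<sigma>)) (form_scale (of_int (E (sort \<sigma>) (sort \<tau>)))
          (form_mult (bary_power v n \<alpha>) (form_mult (bary_prod v n \<sigma>) (B (sort \<tau>)))))"
      unfolding A L_scale[OF sorted_in] L_gen[OF that(1) inc] compl_map_sort[OF that(2,3)] prod ..
    moreover have "form_scale (of_int (E \<sigma> \<tau>))
        (form_mult (bary_power v n \<alpha>) (form_mult (bary_prod v n \<sigma>) (B \<tau>))) =
        form_scale (of_int (E \<sigma> \<tau>)) (form_scale (of_int (sort_sign \<tau>))
          (form_mult (bary_power v n \<alpha>) (form_mult (bary_prod v n \<sigma>) (B (sort \<tau>)))))"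
      by (subst B_sort[OF d(2)]) (simp only: form_mult_scale)
    \<comment> \<open>Sorting \<open>B\<close> contributes \<open>sort_sign \<tau>\<close>, which
      cancels the same factor in the splitting of \<open>E\<close>.\<close>
    moreover have "sort_sign \<sigma> * E (sort \<sigma>) (sort \<tau>) = E \<sigma> \<tau> * sort_sign \<tau>"
      using E_sort[OF that(2)] sort_sign_square[OF d(2)] by (simp add: mult_ac)
    ultimately have "L (form_mult (bary_power v n \<alpha>) (A \<sigma>)) = form_scale (of_int (E \<sigma> \<tau>))
        (form_mult (bary_power v n \<alpha>) (form_mult (bary_prod v n \<sigma>) (B \<tau>)))"
      by (simp only: form.scale_scale flip: of_int_mult)
    moreover have "form_mult (bary_power v n \<alpha>) (A \<sigma>) \<in> X"
      unfolding A X_def by (rule form.span_scale) (use sorted_in X_def in blast)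
    ultimately show ?thesis by blast
  qed
  have "0 \<in> X" unfolding X_def by (rule form.span_zero)
  then have L_zero: "L 0 = 0"
    using L_scale[of 0 0] by (simp only: form.scale_zero_left)
  \<comment> \<open>Membership of the partial sums is carried through the induction because
    \<open>L\<close> is linear only on \<open>X\<close>.\<close>
  have "\<omega> \<in> X \<and> P \<omega> \<in> X \<and> P (L \<omega>) = form_scale (of_int c) (L (P \<omega>))"
    using \<omega>[unfolded X_def]
  proof (induction rule: form.span_induct_alt)
    case base
    show ?case
      using \<open>0 \<in> X\<close> by (simp only: pullback_zero L_zero form.scale_zero_right simp_thms)
  next
    case (step a g \<eta>)
    then obtain \<alpha> \<sigma> where g: "g = form_mult (bary_power v n \<alpha>) (A \<sigma>)"
      and \<alpha>: "\<alpha> \<in> multiindices r n" and \<sigma>: "\<sigma> \<in> inc_maps m n" by blast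
    define \<tau> where "\<tau> = compl_map n \<sigma>"
    have st: "distinct (\<sigma> @ \<tau>)" "set (\<sigma> @ \<tau>) = {..n}" "length \<sigma> = m" "set \<sigma> \<subseteq> {..n}" "set \<tau> \<subseteq> {..n}"
      using \<sigma> by (auto simp: inc_maps_def \<tau>_def compl_map_def strict_sorted_iff)
    have st': "distinct (map \<pi> \<sigma> @ map \<pi> \<tau>)" "set (map \<pi> \<sigma> @ map \<pi> \<tau>) = {..n}" "length (map \<pi> \<sigma>) = m"
      using st(1-3) permutes_image[OF perm] permutes_inj_on[OF perm]
      by (simp_all only: distinct_map set_map length_map flip: map_append)
    have gX: "g \<in> X" unfolding g using gen[OF \<alpha> st(1-3)] by blast
    have Pg: "P g = form_mult (bary_power v n (\<alpha> \<circ> inv \<pi>)) (A (map \<pi> \<sigma>))"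
      unfolding g pullback_bary_power_mult A_perm[OF st(4)] ..
    note gen' = gen[OF multiindices_perm[OF \<alpha>] st']
    have PgX: "P g \<in> X" unfolding Pg using gen' by blast
    have "P (L g) = form_scale (of_int (E \<sigma> \<tau>)) (form_mult (bary_power v n (\<alpha> \<circ> inv \<pi>))
        (form_mult (bary_prod v n (map \<pi> \<sigma>)) (B (map \<pi> \<tau>))))"
      unfolding g gen[OF \<alpha> st(1-3), THEN conjunct2] pullback_scale pullback_bary_power_mult
        pullback_bary_prod_mult[OF st(4)] B_perm[OF st(5)] ..
    \<comment> \<open>The constant \<open>c\<close> is the same for all generators, which lets the
      identity pass to linear combinations.\<close>
    also have "\<dots> = form_scale (of_int c) (L (P g))"
      unfolding Pg gen'[THEN conjunct2] E_perm[OF st(1,2)]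
      by (simp only: form.scale_scale of_int_mult)
    finally have PLg: "P (L g) = form_scale (of_int c) (L (P g))" .
    have sX: "form_scale a g \<in> X" "form_scale a (P g) \<in> X"
      using gX PgX unfolding X_def by (blast intro: form.span_scale)+
    have \<eta>: "\<eta> \<in> X" "P \<eta> \<in> X" "P (L \<eta>) = form_scale (of_int c) (L (P \<eta>))"
      using step.IH by blast+
    have "form_scale a g + \<eta> \<in> X" "form_scale a (P g) + P \<eta> \<in> X"
      using sX \<eta>(1,2) unfolding X_def by (auto intro: form.span_add)
    moreover have "P (L (form_scale a g + \<eta>)) = form_scale (of_int c) (L (form_scale a (P g) + P \<eta>))"
      unfolding L_add[OF sX(1) \<eta>(1)] L_add[OF sX(2) \<eta>(2)] L_scale[OF gX] L_scale[OF PgX]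
        pullback_add pullback_scale PLg \<eta>(3) form.scale_right_distrib form.scale_scale
      by (simp only: mult.commute)
    ultimately show ?case unfolding pullback_add pullback_scale by blast
  qed
  then show ?thesis by blast
qed

end

end

section \<open>Transfer of invariance\<close>

text \<open>This isolates the condition of \<open>invariant_forms\<close> for a single symmetry,
  with an arbitrary map in place of the pullback.\<close>

definition permuted_up_to_units ::
    "(('a, 'f::real_normed_field) form \<Rightarrow> ('a, 'f) form) \<Rightarrow> ('a, 'f) form set \<Rightarrow> bool" where
  "permuted_up_to_units F Q \<longleftrightarrow> (\<exists>\<tau> c. \<tau> permutes Q \<and>
     (\<forall>\<omega>\<in>Q. norm (c \<omega>) = 1 \<and> F \<omega> = form_scale (c \<omega>) (\<tau> \<omega>)))"

lemma permuted_up_to_units_image_iff: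
  assumes inj: "inj_on L X" and QX: "Q \<subseteq> X" and c: "norm c = 1"
    and L_scale: "\<And>a \<omega>. \<omega> \<in> X \<Longrightarrow> L (form_scale a \<omega>) = form_scale a (L \<omega>)"
    and X_scale: "\<And>a \<omega>. \<omega> \<in> X \<Longrightarrow> form_scale a \<omega> \<in> X"
    and F: "\<And>\<omega>. \<omega> \<in> X \<Longrightarrow> F \<omega> \<in> X" "\<And>\<omega>. \<omega> \<in> X \<Longrightarrow> F (L \<omega>) = form_scale c (L (F \<omega>))"
  shows "permuted_up_to_units F Q \<longleftrightarrow> permuted_up_to_units F (L ` Q)"
proof
  have injQ: "inj_on L Q" using inj QX by (rule inj_on_subset)
  then have inv: "inv_into Q L (L \<omega>) = \<omega>" if "\<omega> \<in> Q" for \<omega> using that by simp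
  assume "permuted_up_to_units F Q"
  then obtain \<tau> d where \<tau>: "\<tau> permutes Q"
    and d: "\<And>\<omega>. \<omega> \<in> Q \<Longrightarrow> norm (d \<omega>) = 1" "\<And>\<omega>. \<omega> \<in> Q \<Longrightarrow> F \<omega> = form_scale (d \<omega>) (\<tau> \<omega>)"
    unfolding permuted_up_to_units_def by blast
  have "map_permutation Q L \<tau> permutes L ` Q"
    using \<tau> injQ by (intro map_permutation_permutes) (auto simp: bij_betw_def)
  moreover have "F (L \<omega>) = form_scale (c * d \<omega>) (map_permutation Q L \<tau> (L \<omega>))" if "\<omega> \<in> Q" for \<omega>
  proof -
    have "\<tau> \<omega> \<in> X" "\<omega> \<in> X" using permutes_in_image[OF \<tau>] that QX by auto
    moreover have "map_permutation Q L \<tau> (L \<omega>) = L (\<tau> \<omega>)"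
      using that by (simp add: map_permutation_def restrict_id_def inv)
    ultimately show ?thesis
      using that by (simp only: F(2) d(2) L_scale form.scale_scale)
  qed
  moreover have "norm (c * d \<omega>) = 1" if "\<omega> \<in> Q" for \<omega>
    using c d(1)[OF that] by (simp add: norm_mult)
  ultimately show "permuted_up_to_units F (L ` Q)"
    unfolding permuted_up_to_units_def
    by (intro exI[of _ "map_permutation Q L \<tau>"] exI[of _ "\<lambda>\<eta>. c * d (inv_into Q L \<eta>)"])
      (simp add: inv)
next
  have injQ: "inj_on L Q" using inj QX by (rule inj_on_subset)
  then have inv: "inv_into Q L (L \<omega>) = \<omega>" if "\<omega> \<in> Q" for \<omega> using that by simp
  assume "permuted_up_to_units F (L ` Q)"
  then obtain \<tau> d where \<tau>: "\<tau> permutes L ` Q"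
    and d: "\<And>\<omega>. \<omega> \<in> Q \<Longrightarrow> norm (d (L \<omega>)) = 1"
      "\<And>\<omega>. \<omega> \<in> Q \<Longrightarrow> F (L \<omega>) = form_scale (d (L \<omega>)) (\<tau> (L \<omega>))"
    unfolding permuted_up_to_units_def by blast
  \<comment> \<open>The permutation of the image is conjugated back by the inverse of
    \<open>L\<close> on \<open>Q\<close>.\<close>
  let ?\<tau> = "map_permutation (L ` Q) (inv_into Q L) \<tau>"
  have "bij_betw (inv_into Q L) (L ` Q) Q"
    using injQ by (intro bij_betw_inv_into) (simp add: bij_betw_def)
  then have \<tau>': "?\<tau> permutes Q"
    using \<tau> by (intro map_permutation_permutes)
  moreover have "F \<omega> = form_scale (d (L \<omega>) / c) (?\<tau> \<omega>)" if "\<omega> \<in> Q" for \<omega>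
  proof -
    have X: "?\<tau> \<omega> \<in> X" "\<omega> \<in> X" using permutes_in_image[OF \<tau>'] that QX by auto
    have "inv_into (L ` Q) (inv_into Q L) \<omega> = L \<omega>"
      using that inv injQ by (intro inv_into_f_eq inj_on_inv_into) auto
    moreover have "\<omega> \<in> inv_into Q L ` L ` Q"
      using that inv by (metis imageI)
    ultimately have "?\<tau> \<omega> = inv_into Q L (\<tau> (L \<omega>))"
      by (simp add: map_permutation_def restrict_id_def)
    moreover have "\<tau> (L \<omega>) \<in> L ` Q" using permutes_in_image[OF \<tau>] that by blast
    ultimately have L\<tau>: "L (?\<tau> \<omega>) = \<tau> (L \<omega>)" by (simp only: f_inv_into_f)
    \<comment> \<open>Both sides equal \<open>F (L \<omega>)\<close>. After division by
      \<open>c\<close>, nonzero since its norm is 1, injectivity of \<open>L\<close> on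
      \<open>X\<close> removes \<open>L\<close>.\<close>
    have "form_scale c (L (F \<omega>)) = form_scale (d (L \<omega>)) (L (?\<tau> \<omega>))"
      using d(2)[OF that] F(2)[OF X(2)] L\<tau> by (simp only:)
    then have "form_scale (inverse c) (form_scale c (L (F \<omega>))) =
        form_scale (inverse c) (form_scale (d (L \<omega>)) (L (?\<tau> \<omega>)))" by (simp only:)
    moreover have "inverse c * c = 1" using c by (intro left_inverse) auto
    ultimately have "L (F \<omega>) = L (form_scale (d (L \<omega>) / c) (?\<tau> \<omega>))"
      by (simp only: L_scale[OF X(1)] form.scale_scale form.scale_one divide_inverse mult.commute)
    then show ?thesis
      using inj F(1)[OF X(2)] X_scale[OF X(1)] by (simp only: inj_on_eq_iff)
  qed
  moreover have "norm (d (L \<omega>) / c) = 1" if "\<omega> \<in> Q" for \<omega>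
    using c d(1)[OF that] by (simp add: norm_divide)
  ultimately show "permuted_up_to_units F Q"
    unfolding permuted_up_to_units_def
    by (intro exI[of _ ?\<tau>] exI[of _ "\<lambda>\<omega>. d (L \<omega>) / c"]) blast
qed

text \<open>The factor \<open>c\<close> may depend on \<open>\<pi>\<close> but not on the form, so
  the transfer is made for each permutation separately.\<close>

lemma invariant_forms_image_iff:
  assumes L: "form_iso X Y L" and Q: "finite Q" "Q \<subseteq> X"
    and X_scale: "\<And>a \<omega>. \<omega> \<in> X \<Longrightarrow> form_scale a \<omega> \<in> X"
    and pullback: "\<And>\<pi>. \<pi> permutes {..n} \<Longrightarrow> \<exists>c. norm c = 1 \<and> (\<forall>\<omega>\<in>X.
      pullback (simplex_of v n) (simplex_sym v n \<pi>) \<omega> \<in> X \<and>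
      pullback (simplex_of v n) (simplex_sym v n \<pi>) (L \<omega>) =
        form_scale c (L (pullback (simplex_of v n) (simplex_sym v n \<pi>) \<omega>)))"
  shows "invariant_forms v n Q \<longleftrightarrow> invariant_forms v n (L ` Q)"
proof -
  have "permuted_up_to_units (pullback (simplex_of v n) (simplex_sym v n \<pi>)) Q \<longleftrightarrow>
      permuted_up_to_units (pullback (simplex_of v n) (simplex_sym v n \<pi>)) (L ` Q)"
    if "\<pi> permutes {..n}" for \<pi>
    using pullback[OF that] L Q(2) X_scale
    by (elim exE conjE, intro permuted_up_to_units_image_iff[where X = X])
      (auto simp: form_iso_def bij_betw_def)
  then show ?thesis
    using Q(1) by (simp add: invariant_forms_def permuted_up_to_units_def)
qed

section \<open>Invariance under the canonical isomorphisms\<close>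

context simplex
begin

lemma norm_sort_sign_perm:
  assumes "\<pi> permutes {..n}"
  shows "norm (of_int (sort_sign (map \<pi> [0..<Suc n])) :: 'f::real_normed_field) = 1"
  using permutes_inj_on[OF assms] by (intro norm_sort_sign) (simp only: distinct_map distinct_upt)

lemma sort_sign_append_map_permutes:
  assumes "\<pi> permutes {..n}" "distinct (\<sigma> @ \<tau>)" "set (\<sigma> @ \<tau>) = {..n}"
  shows "sort_sign (\<sigma> @ \<tau>) = sort_sign (map \<pi> [0..<Suc n]) * sort_sign (map \<pi> \<sigma> @ map \<pi> \<tau>)"
  using sort_sign_map_permutes[OF assms] by (simp only: map_append)

lemma canonical_iso_I_invariant_iff:
  fixes I :: "('a, 'f::real_normed_field) form \<Rightarrow> ('a, 'f) form"
  assumes I: "canonical_iso_I v n k r I" and k: "k \<le> n"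
    and Q: "finite Q" "Q \<subseteq> poly_forms v n r (int k)"
  shows "invariant_forms v n Q \<longleftrightarrow> invariant_forms v n (I ` Q)"
proof -
  have X: "poly_forms v n r (int k) = (form.span {form_mult (bary_power v n \<alpha>) (dbary v n \<sigma>) | \<alpha> \<sigma>.
      \<alpha> \<in> multiindices (int r) n \<and> \<sigma> \<in> inc_maps k n} :: ('a, 'f) form set)"
    using k by (simp add: poly_forms_def)
  show ?thesis
  proof (rule invariant_forms_image_iff[OF _ Q])
    show "form_iso (poly_forms v n r (int k)) (poly_forms_minus0 v n (r + k + 1) (int n - int k)) I"
      using I by (simp only: canonical_iso_I_def)
    show "form_scale a \<omega> \<in> poly_forms v n r (int k)" if "\<omega> \<in> poly_forms v n r (int k)"
      for a and \<omega> :: "('a, 'f) form"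
      using that unfolding X by (rule form.span_scale)
    fix \<pi> assume \<pi>: "\<pi> permutes {..n}"
    have "P \<pi> \<omega> \<in> poly_forms v n r (int k) \<and>
        P \<pi> (I \<omega>) = form_scale (of_int (sort_sign (map \<pi> [0..<Suc n]))) (I (P \<pi> \<omega>))"
      if "\<omega> \<in> poly_forms v n r (int k)" for \<omega>
      unfolding X
    proof (rule equivariant_on_span[OF \<pi> dbary_sort whitney_sort pullback_dbary[OF \<pi>]
          pullback_whitney[OF \<pi>], where E = "\<lambda>\<sigma> \<tau>. sort_sign (\<sigma> @ \<tau>)"], goal_cases)
      \<comment> \<open>The two cases are the laws for \<open>E\<close>: splitting off the signs of
        the blocks, and behaviour under \<open>\<pi>\<close>.\<close>
      case (5 \<sigma> \<tau>)
      then show ?case by (rule sort_sign_append)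
    next
      case (6 \<sigma> \<tau>)
      then show ?case by (rule sort_sign_append_map_permutes[OF \<pi>])
    qed (use I that in \<open>simp_all only: canonical_iso_I_def form_iso_def X\<close>)
    then show "\<exists>c :: 'f. norm c = 1 \<and> (\<forall>\<omega>\<in>poly_forms v n r (int k).
        P \<pi> \<omega> \<in> poly_forms v n r (int k) \<and> P \<pi> (I \<omega>) = form_scale c (I (P \<pi> \<omega>)))"
      using norm_sort_sign_perm[OF \<pi>] by blast
  qed
qed

lemma canonical_iso_J_invariant_iff:
  fixes J :: "('a, 'f::real_normed_field) form \<Rightarrow> ('a, 'f) form"
  assumes J: "canonical_iso_J v n k r J" and k: "k \<le> n"
    and Q: "finite Q" "Q \<subseteq> poly_forms_minus v n (r + 1) (int k)"
  shows "invariant_forms v n Q \<longleftrightarrow> invariant_forms v n (J ` Q)"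
proof -
  \<comment> \<open>Index \<open>r + 1\<close> means coefficients of degree \<open>r\<close>, and
    the lists of Whitney forms have \<open>k + 1\<close> entries.\<close>
  have X: "poly_forms_minus v n (r + 1) (int k) =
      (form.span {form_mult (bary_power v n \<alpha>) (whitney v n \<rho>) | \<alpha> \<rho>.
        \<alpha> \<in> multiindices (int r) n \<and> \<rho> \<in> inc_maps (Suc k) n} :: ('a, 'f) form set)"
    using k by (simp add: poly_forms_minus_def inc_maps0_def)
  show ?thesis
  proof (rule invariant_forms_image_iff[OF _ Q])
    show "form_iso (poly_forms_minus v n (r + 1) (int k)) (poly_forms0 v n (r + k + 1) (int n - int k)) J"
      using J by (simp only: canonical_iso_J_def)
    show "form_scale a \<omega> \<in> poly_forms_minus v n (r + 1) (int k)"
      if "\<omega> \<in> poly_forms_minus v n (r + 1) (int k)" for a and \<omega> :: "('a, 'f) form"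
      using that unfolding X by (rule form.span_scale)
    fix \<pi> assume \<pi>: "\<pi> permutes {..n}"
    have "P \<pi> \<omega> \<in> poly_forms_minus v n (r + 1) (int k) \<and>
        P \<pi> (J \<omega>) = form_scale (of_int (sort_sign (map \<pi> [0..<Suc n]))) (J (P \<pi> \<omega>))"
      if "\<omega> \<in> poly_forms_minus v n (r + 1) (int k)" for \<omega>
      unfolding X
    proof (rule equivariant_on_span[OF \<pi> whitney_sort dbary_sort pullback_whitney[OF \<pi>]
          pullback_dbary[OF \<pi>], where E = "\<lambda>\<sigma> \<tau>. sort_sign (\<tau> @ \<sigma>)"], goal_cases)
      case (5 \<sigma> \<tau>)
      \<comment> \<open>Here the complement comes first in the sign, so the splitting law is used
        with the blocks exchanged.\<close>
      then show ?case using sort_sign_append[of \<tau> \<sigma>] by (auto simp: mult_ac)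
    next
      case (6 \<sigma> \<tau>)
      then show ?case by (intro sort_sign_append_map_permutes[OF \<pi>]) auto
    qed (use J that in \<open>simp_all only: canonical_iso_J_def form_iso_def inc_maps0_def X\<close>)
    then show "\<exists>c :: 'f. norm c = 1 \<and> (\<forall>\<omega>\<in>poly_forms_minus v n (r + 1) (int k).
        P \<pi> \<omega> \<in> poly_forms_minus v n (r + 1) (int k) \<and> P \<pi> (J \<omega>) = form_scale c (J (P \<pi> \<omega>)))"
      using norm_sort_sign_perm[OF \<pi>] by blast
  qed
qed

end

text \<open>This settles \<open>k > n\<close>: a bijection of the zero space fixes 0, so
  \<open>Q\<close> is its own image.\<close>

lemma form_iso_zero_image:
  assumes "form_iso {0} {0} L" "Q \<subseteq> {0}"
  shows "L ` Q = Q"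
  using assms by (auto simp: form_iso_def bij_betw_def)

theorem corollary6p3:
  fixes v :: "nat \<Rightarrow> 'a::euclidean_space"
    and n k r :: nat
    and I J :: "('a, 'f::real_normed_field) form \<Rightarrow> ('a, 'f) form"
  assumes "simplex_vertices v n"
    and "canonical_iso_I v n k r I"
    and "canonical_iso_J v n k r J"
  shows "(\<forall>Q. finite Q \<and> Q \<subseteq> poly_forms v n r (int k) \<longrightarrow>
            (invariant_forms v n Q \<longleftrightarrow> invariant_forms v n (I ` Q))) \<and>
         (\<forall>Q. finite Q \<and> Q \<subseteq> poly_forms_minus v n (r + 1) (int k) \<longrightarrow>
            (invariant_forms v n Q \<longleftrightarrow> invariant_forms v n (J ` Q)))"
proof (cases "k \<le> n")
  case True
  interpret simplex v n by unfold_locales (rule assms(1))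
  show ?thesis
    using canonical_iso_I_invariant_iff[OF assms(2) True]
      canonical_iso_J_invariant_iff[OF assms(3) True] by blast
next
  case False
  then have zero: "poly_forms v n r (int k) = ({0} :: ('a, 'f) form set)"
      "poly_forms_minus v n (r + 1) (int k) = ({0} :: ('a, 'f) form set)"
      "poly_forms_minus v n (r + k + 1) (int n - int k) = ({0} :: ('a, 'f) form set)"
      "poly_forms v n (r + k + 1) (int n - int k) = ({0} :: ('a, 'f) form set)"
    by (simp_all add: poly_forms_def poly_forms_minus_def)
  \<comment> \<open>The zero form has vanishing traces, so the spaces with vanishing trace are
    \<open>{0}\<close> rather than empty.\<close>
  have "vanishing_trace v n (0 :: ('a, 'f) form)"
    by (simp only: vanishing_trace_def pullback_zero simp_thms)
  then have "poly_forms_minus0 v n (r + k + 1) (int n - int k) = ({0} :: ('a, 'f) form set)"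
      "poly_forms0 v n (r + k + 1) (int n - int k) = ({0} :: ('a, 'f) form set)"
    using zero(3,4) by (auto simp only: poly_forms_minus0_def poly_forms0_def)
  then have "form_iso {0} {0} I" "form_iso {0} {0} J"
    using assms(2,3) zero(1,2) by (simp_all only: canonical_iso_I_def canonical_iso_J_def)
  then show ?thesis
    unfolding zero(1,2) by (metis form_iso_zero_image)
qed

end
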